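(* Let $D\subset\mathbb R^d$ be a bounded open set with $\mathcal C^2$ boundary. Then there is a constant $C_D$ depending on $D$ (and not on $n$) such that $$K_n\le C_D\,n^{\frac{d+1}{d}},\qquad n\ge1,$$ for all $n$ of the form $n=\binom{d+\ell}{\ell}$, $\ell\ge0$, where $K_n$ is associated to the space $V_n=\mathbb P_\ell$ of polynomials of total degree at most $\ell$.
   Context: $D$ is equipped with the uniform probability measure $\mu=|D|^{-1}\chi_D\,dx$ ($|\cdot|$ is Lebesgue measure) and $L^2(D)=L^2(D,\mu)$. $\mathbb P_\ell$ is the space of real polynomials in $d$ variables of total degree at most $\ell$, of dimension $n=\binom{d+\ell}{\ell}$; $V_n=\mathbb P_\ell$. Define $k_n(x)=\max_{v\in V_n\setminus\{0\}}\frac{|v(x)|^2}{\|v\|_{L^2(D)}^2}$ and $K_n=\sup_{x\in D}k_n(x)$. *)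

theory Defs
  imports "HOL-Analysis.Analysis"
begin

text \<open>
  Points of \<open>d\<close>-dimensional Euclidean space are vectors of type \<^typ>\<open>real ^ 'd\<close>, where
  \<open>d = CARD('d) \<ge> 1\<close>, and real polynomials in \<open>d\<close> variables are identified with the functions
  they induce, which is harmless since the field is infinite.
\<close>

definition polys_upto :: "nat \<Rightarrow> (real ^ 'd \<Rightarrow> real) set" where
  "polys_upto l =
     {p. \<exists>c :: ('d \<Rightarrow> nat) \<Rightarrow> real.
        p = (\<lambda>x. \<Sum>\<alpha> | (\<Sum>i\<in>UNIV. \<alpha> i) \<le> l. c \<alpha> * (\<Prod>i\<in>UNIV. (x $ i) ^ \<alpha> i))}"

definition norm_L2 :: "(real ^ 'd) set \<Rightarrow> (real ^ 'd \<Rightarrow> real) \<Rightarrow> real" where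
  "norm_L2 D v = sqrt (\<integral>x. \<bar>v x\<bar>\<^sup>2 \<partial>uniform_measure lborel D)"

text \<open>
  The maximum defining \<open>k\<^sub>n\<close> is written as a supremum, with which it agrees whenever it is
  attained. Both suprema are taken in \<^typ>\<open>ereal\<close>: an upper bound on them therefore includes the
  assertion that they are finite.
\<close>

definition k_fun ::
    "(real ^ 'd) set \<Rightarrow> (real ^ 'd \<Rightarrow> real) set \<Rightarrow> real ^ 'd \<Rightarrow> ereal" where
  "k_fun D V x = (SUP v\<in>V - {\<lambda>_. 0}. ereal (\<bar>v x\<bar>\<^sup>2 / (norm_L2 D v)\<^sup>2))"

definition K_const :: "(real ^ 'd) set \<Rightarrow> (real ^ 'd \<Rightarrow> real) set \<Rightarrow> ereal" where
  "K_const D V = (SUP x\<in>D. k_fun D V x)"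

definition C2_function :: "(real ^ 'd \<Rightarrow> real) \<Rightarrow> bool" where
  "C2_function f \<longleftrightarrow>
     (\<exists>(g :: real ^ 'd \<Rightarrow> real ^ 'd) (H :: real ^ 'd \<Rightarrow> real ^ 'd ^ 'd).
        (\<forall>x. (f has_derivative (\<lambda>h. g x \<bullet> h)) (at x)) \<and>
        (\<forall>x. (g has_derivative (\<lambda>h. H x *v h)) (at x)) \<and>
        continuous_on UNIV H)"

text \<open>
  Near each boundary point, after relabelling and reorienting the coordinate axes (choice of
  the index \<open>i\<close> and of the sign \<open>s\<close>), the set is the region on one side of the graph of a \<open>C\<^sup>2\<close>
  function of the remaining \<open>d - 1\<close> coordinates. Such a function is represented by a function on
  the whole space that does not depend on the \<open>i\<close>-th coordinate; for \<open>d = 1\<close> it is a constant.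
\<close>

definition C2_boundary :: "(real ^ 'd) set \<Rightarrow> bool" where
  "C2_boundary D \<longleftrightarrow>
     (\<forall>p\<in>frontier D. \<exists>r>0. \<exists>i. \<exists>s\<in>{1, -1}. \<exists>\<gamma>.
        C2_function \<gamma> \<and>
        (\<forall>x y. (\<forall>j. j \<noteq> i \<longrightarrow> x $ j = y $ j) \<longrightarrow> \<gamma> x = \<gamma> y) \<and>
        D \<inter> ball p r = {x \<in> ball p r. s * x $ i > \<gamma> x})"

end

theory Submission
  imports Defs "HOL-Complex_Analysis.Conformal_Mappings"
begin

text \<open>
  The maximum of \<open>|v x|\<^sup>2 / (norm_L2 D v)\<^sup>2\<close> is of the size claimed because a polynomial \<open>v\<close> of degree \<open>l\<close>
  cannot fall off quickly from its maximal modulus \<open>M\<close>: it stays above \<open>M / 2\<close> on a subset of \<open>D\<close> whose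
  volume is at least of order \<open>(l + 1) ^ -(d + 1)\<close>, and hence
  \<open>(norm_L2 D v)\<^sup>2 \<ge> const * M\<^sup>2 / (l + 1) ^ (d + 1)\<close>. As \<open>n = (d + l) choose l\<close> is at least of order
  \<open>(l + 1) ^ d\<close>, this is the bound by \<open>n powr ((d + 1) / d)\<close>.

  The regularity of the boundary enters only through the interior sphere condition
  (\<open>C2_boundary_inner_ball\<close>): there is one radius \<open>r\<close> such that every point of \<open>D\<close>, near the boundary
  or not, lies on the boundary of a ball of radius \<open>r\<close> contained in \<open>D\<close>. Take such a ball \<open>B\<close> for a
  point \<open>x0\<close> where \<open>|v|\<close> is close to \<open>M\<close>. The ellipses in \<open>B\<close> that have the centre of \<open>B\<close> as their centre
  and \<open>x0\<close> as a vertex, followed from \<open>x0\<close> up to the parameter \<open>\<delta>\<close>, fill the spherical cap at \<open>x0\<close>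
  that a plane at distance \<open>r * cos \<delta>\<close> from the centre cuts off. Along
  such an ellipse \<open>v\<close> is a trigonometric polynomial of degree \<open>l\<close> bounded by \<open>M\<close>, and Bernstein's
  inequality (\<open>polynomial_variation_along_ellipse\<close>) shows that it varies by at most
  \<open>exp 1 * (l + 1) * M * \<delta>\<close>. So \<open>\<delta>\<close> may be chosen of order \<open>1 / (l + 1)\<close>
  (\<open>polynomial_large_on_cap\<close>). The cap has depth of order \<open>\<delta>\<^sup>2\<close> in the normal direction and width of
  order \<open>\<delta>\<close> in the \<open>d - 1\<close> tangential ones, that is volume of order \<open>\<delta> ^ (d + 1)\<close>
  (\<open>polynomial_large_on_big_set\<close>).
\<close>

section \<open>Bernstein's inequality along ellipses\<close>

text \<open>
  A trigonometric polynomial of degree at most \<open>l\<close>, continued to the complex plane as \<open>F\<close>, becomes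
  after multiplication by \<open>exp (\<i> * \<zeta>) ^ l\<close> a polynomial \<open>P\<close> in \<open>exp (\<i> * \<zeta>)\<close>. The real axis
  corresponds to the unit circle and the upper half plane to the punctured unit disc, so the
  maximum principle for \<open>P\<close> controls \<open>F\<close> on the whole upper half plane.
\<close>

lemma upper_half_plane_growth:
  fixes F P :: "complex \<Rightarrow> complex" and l :: nat
  assumes holP: "P holomorphic_on UNIV"
    and PF: "\<And>\<zeta>. P (exp (\<i> * \<zeta>)) = exp (\<i> * \<zeta>) ^ l * F \<zeta>"
    and bound: "\<And>t::real. cmod (F (of_real t)) \<le> M"
    and "0 \<le> Im \<zeta>"
  shows "cmod (F \<zeta>) \<le> M * exp (real l * Im \<zeta>)"
proof -
  have circle: "cmod (P z) \<le> M" if z1: "cmod z = 1" for z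
  proof -
    obtain t where "z = exp (\<i> * complex_of_real t)"
      using z1 complex_norm_eq_1_exp[of z] by metis
    then show ?thesis
      using PF[of "of_real t"] bound[of t] z1 by (simp add: norm_mult norm_power)
  qed
  have "cmod (P (exp (\<i> * \<zeta>))) \<le> M"
  proof (rule maximum_modulus_frontier[where f = P and S = "cball 0 1"])
    show "P holomorphic_on interior (cball 0 1)"
      using holP holomorphic_on_subset by blast
    show "continuous_on (closure (cball 0 1)) P"
      using holP holomorphic_on_imp_continuous_on continuous_on_subset by blast
    show "exp (\<i> * \<zeta>) \<in> cball 0 1"
      using \<open>0 \<le> Im \<zeta>\<close> by simp
  qed (use circle in auto)
  then have "exp (- Im \<zeta>) ^ l * cmod (F \<zeta>) \<le> M"
    by (simp add: PF norm_mult norm_power)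
  then have "exp (- (real l * Im \<zeta>)) * cmod (F \<zeta>) \<le> M"
    by (simp add: exp_of_nat_mult[symmetric])
  then show ?thesis
    by (simp add: exp_minus field_simps)
qed

text \<open>
  A form of Bernstein's inequality. Restricted to an ellipse, a polynomial of degree at most \<open>l\<close> is a
  trigonometric polynomial of degree at most \<open>l\<close>, whose continuation \<open>F\<close> to complex \<open>\<zeta>\<close> is bounded
  by \<open>M * exp (l * \<bar>Im \<zeta>\<bar>)\<close>. On discs of radius \<open>1 / (l + 1)\<close> centred on the real axis this
  is at most \<open>exp 1 * M\<close>, and Cauchy's estimate bounds the derivative by \<open>exp 1 * (l + 1) * M\<close>.
  The constant \<open>exp 1\<close> is not optimal, but only the linear growth in \<open>l\<close> matters.
\<close>

lemma polynomial_variation_along_ellipse: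
  fixes p :: "real ^ 'd \<Rightarrow> real"
  assumes p: "p \<in> polys_upto l"
    and bound: "\<And>t. \<bar>p (x + cos t *\<^sub>R a + sin t *\<^sub>R b)\<bar> \<le> M"
  shows "\<bar>p (x + cos t *\<^sub>R a + sin t *\<^sub>R b) - p (x + a)\<bar> \<le> exp 1 * (real l + 1) * M * \<bar>t\<bar>"
proof -
  define A :: "('d \<Rightarrow> nat) set" where "A = {\<alpha>. (\<Sum>i\<in>UNIV. \<alpha> i) \<le> l}"
  obtain c where p_eq: "p = (\<lambda>x. \<Sum>\<alpha>\<in>A. c \<alpha> * (\<Prod>i\<in>UNIV. (x $ i) ^ \<alpha> i))"
    using p by (auto simp: polys_upto_def A_def)
  define F where "F = (\<lambda>b :: real ^ 'd. \<lambda>\<zeta> :: complex. \<Sum>\<alpha>\<in>A. of_real (c \<alpha>) *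
      (\<Prod>i\<in>UNIV. (of_real (x $ i) + cos \<zeta> * of_real (a $ i) + sin \<zeta> * of_real (b $ i)) ^ \<alpha> i))"
  \<comment> \<open>Each coordinate along the ellipse, multiplied by \<open>z = exp (\<i> * \<zeta>)\<close>, is a polynomial in \<open>z\<close>; a monomial
    of degree \<open>k \<le> l\<close> absorbs \<open>k\<close> of the \<open>l\<close> factors \<open>z\<close>.\<close>
  define P where "P = (\<lambda>b :: real ^ 'd. \<lambda>z :: complex. \<Sum>\<alpha>\<in>A. of_real (c \<alpha>) * z ^ (l - (\<Sum>i\<in>UNIV. \<alpha> i)) *
      (\<Prod>i\<in>UNIV. (z * of_real (x $ i) + (z\<^sup>2 + 1) / 2 * of_real (a $ i)
         - \<i> * (z\<^sup>2 - 1) / 2 * of_real (b $ i)) ^ \<alpha> i))"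
  have F_real: "F b (of_real t) = of_real (p (x + cos t *\<^sub>R a + sin t *\<^sub>R b))" for t b
    by (simp add: F_def p_eq cos_of_real sin_of_real)
  have P_hol: "P b holomorphic_on UNIV" for b
    unfolding P_def by (intro holomorphic_intros) simp_all
  have F_hol: "F b holomorphic_on S" for b S
    unfolding F_def by (intro holomorphic_intros)
  have PF: "P b (exp (\<i> * \<zeta>)) = exp (\<i> * \<zeta>) ^ l * F b \<zeta>" for b \<zeta>
  proof -
    define z where "z = exp (\<i> * \<zeta>)"
    have z0: "z \<noteq> 0" by (simp add: z_def)
    have cos: "(z\<^sup>2 + 1) / 2 = z * cos \<zeta>"
      using z0 by (simp add: cos_exp_eq z_def exp_minus divide_simps power2_eq_square)
    have sin: "\<i> * (z\<^sup>2 - 1) / 2 = - (z * sin \<zeta>)"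
      using z0 by (simp add: sin_exp_eq z_def exp_minus divide_simps power2_eq_square)
    have lin: "z * of_real (x $ i) + (z\<^sup>2 + 1) / 2 * of_real (a $ i) - \<i> * (z\<^sup>2 - 1) / 2 * of_real (b $ i)
       = z * (of_real (x $ i) + cos \<zeta> * of_real (a $ i) + sin \<zeta> * of_real (b $ i))" for i
      unfolding cos sin by (simp add: algebra_simps)
    have "P b z = (\<Sum>\<alpha>\<in>A. z ^ l * (of_real (c \<alpha>) *
      (\<Prod>i\<in>UNIV. (of_real (x $ i) + cos \<zeta> * of_real (a $ i) + sin \<zeta> * of_real (b $ i)) ^ \<alpha> i)))"
      unfolding P_def
    proof (rule sum.cong[OF refl])
      fix \<alpha> assume "\<alpha> \<in> A"
      then have "z ^ l = z ^ (l - (\<Sum>i\<in>UNIV. \<alpha> i)) * (\<Prod>i\<in>UNIV. z ^ \<alpha> i)"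
        by (simp add: A_def power_sum[symmetric] power_add[symmetric])
      then show "of_real (c \<alpha>) * z ^ (l - (\<Sum>i\<in>UNIV. \<alpha> i)) *
      (\<Prod>i\<in>UNIV. (z * of_real (x $ i) + (z\<^sup>2 + 1) / 2 * of_real (a $ i)
         - \<i> * (z\<^sup>2 - 1) / 2 * of_real (b $ i)) ^ \<alpha> i) = z ^ l * (of_real (c \<alpha>) *
      (\<Prod>i\<in>UNIV. (of_real (x $ i) + cos \<zeta> * of_real (a $ i) + sin \<zeta> * of_real (b $ i)) ^ \<alpha> i))"
        unfolding lin power_mult_distrib prod.distrib by simp
    qed
    then show ?thesis
      by (simp add: F_def z_def sum_distrib_left)
  qed
  \<comment> \<open>Replacing \<open>(b, \<zeta>)\<close> by \<open>(- b, - \<zeta>)\<close> leaves \<open>F\<close> unchanged and exchanges the two half planes.\<close>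
  have growth: "cmod (F b \<zeta>) \<le> M * exp (real l * \<bar>Im \<zeta>\<bar>)" for \<zeta>
  proof (cases "0 \<le> Im \<zeta>")
    case True
    show ?thesis
      using upper_half_plane_growth[OF P_hol PF _ True, of b M] bound True by (simp add: F_real)
  next
    case False
    have sym: "F (- b) (- \<zeta>) = F b \<zeta>"
      by (simp add: F_def)
    have "\<bar>p (x + cos t *\<^sub>R a + sin t *\<^sub>R (- b))\<bar> \<le> M" for t
      using bound[of "- t"] by simp
    then show ?thesis
      using upper_half_plane_growth[OF P_hol PF, of "- b" M "- \<zeta>"] False by (simp add: F_real sym)
  qed
  have M: "0 \<le> M" using bound[of 0] by linarith
  have deriv_bound: "cmod (deriv (F b) \<xi>) \<le> exp 1 * (real l + 1) * M" if "\<xi> \<in> \<real>" for \<xi>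
  proof -
    define r where "r = 1 / (real l + 1)"
    have "cmod ((deriv ^^ 1) (F b) \<xi>) \<le> fact 1 * (M * exp 1) / r ^ 1"
    proof (rule Cauchy_inequality)
      show "0 < r" by (simp add: r_def)
      show "F b holomorphic_on ball \<xi> r" by (rule F_hol)
      show "continuous_on (cball \<xi> r) (F b)" by (rule holomorphic_on_imp_continuous_on[OF F_hol])
      fix \<zeta> assume "cmod (\<xi> - \<zeta>) = r"
      then have "\<bar>Im \<zeta>\<bar> \<le> r"
        using abs_Im_le_cmod[of "\<xi> - \<zeta>"] \<open>\<xi> \<in> \<real>\<close> by (simp add: complex_is_Real_iff)
      then have "real l * \<bar>Im \<zeta>\<bar> \<le> real l * r" by (simp add: mult_left_mono)
      also have "\<dots> \<le> 1" by (simp add: r_def)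
      finally show "cmod (F b \<zeta>) \<le> M * exp 1"
        using growth[of \<zeta>] M by (smt (verit) exp_le_cancel_iff mult_left_mono)
    qed
    then show ?thesis by (simp add: r_def mult_ac)
  qed
  have "cmod (F b (of_real t) - F b (of_real 0)) \<le> exp 1 * (real l + 1) * M * cmod (of_real t - of_real 0)"
  proof (rule field_differentiable_bound[OF convex_Reals _ deriv_bound])
    fix z show "(F b has_field_derivative deriv (F b) z) (at z within \<real>)"
      by (meson F_hol UNIV_I holomorphic_derivI open_UNIV DERIV_subset subset_UNIV)
  qed auto
  then show ?thesis
    unfolding F_real by (simp flip: of_real_diff)
qed

section \<open>Volume of slabs\<close>

text \<open>
  The volume of a disc-shaped slab of radius \<open>\<rho>\<close> and thickness \<open>h\<close> is of order \<open>\<rho> ^ (d - 1) * h\<close>. The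
  slab may have any direction \<open>e\<close>; translation invariance suffices for this: about \<open>2 * \<rho> / h\<close>
  translates of the slab in the direction \<open>e\<close> cover a ball of radius \<open>\<rho>\<close>.
\<close>

lemma disc_slab_volume:
  fixes e :: "'a :: euclidean_space" and a h \<rho> :: real
  assumes e: "norm e = 1" and h: "0 < h" "h \<le> \<rho>"
  defines "S \<equiv> {u. a \<le> u \<bullet> e \<and> u \<bullet> e < a + h \<and> norm (u - (u \<bullet> e) *\<^sub>R e) < \<rho>}"
  shows "S \<in> sets borel"
    and "unit_ball_vol (real DIM('a)) * \<rho> ^ (DIM('a) - 1) * h / 4 \<le> measure lborel S"
proof -
  have ee: "e \<bullet> e = 1" using e by (simp add: norm_eq_1)
  show S_borel: "S \<in> sets borel"
    unfolding S_def by measurable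
  have "bounded S"
  proof (rule boundedI)
    fix u assume u: "u \<in> S"
    have "norm u \<le> norm (u - (u \<bullet> e) *\<^sub>R e) + norm ((u \<bullet> e) *\<^sub>R e)"
      by (metis diff_add_cancel norm_triangle_ineq)
    then show "norm u \<le> \<rho> + (\<bar>a\<bar> + h)"
      using u e by (auto simp: S_def)
  qed
  then have S_lm: "S \<in> lmeasurable"
    using S_borel by (intro bounded_set_imp_lmeasurable) auto
  \<comment> \<open>The ball is cut into \<open>2 * N\<close> layers of thickness \<open>h\<close>, \<open>N\<close> on either side of its centre.\<close>
  define N where "N = \<lceil>\<rho> / h\<rceil>"
  define I where "I = {- N..<N}"
  define T where "T = (\<lambda>k::int. (+) ((of_int k * h) *\<^sub>R e) ` S)"
  have T_lm: "T k \<in> lmeasurable" and T_meas: "measure lebesgue (T k) = measure lebesgue S" for k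
    unfolding T_def using S_lm by (simp_all add: measurable_translation measure_translation)
  have cover: "ball (a *\<^sub>R e) \<rho> \<subseteq> (\<Union>k\<in>I. T k)"
  proof
    fix u assume "u \<in> ball (a *\<^sub>R e) \<rho>"
    then have u: "norm (u - a *\<^sub>R e) < \<rho>"
      by (simp add: dist_norm norm_minus_commute)
    define t where "t = u \<bullet> e - a"
    have t: "t = (u - a *\<^sub>R e) \<bullet> e" by (simp add: t_def inner_diff_left ee)
    have t_less: "\<bar>t\<bar> < \<rho>"
      using Cauchy_Schwarz_ineq2[of "u - a *\<^sub>R e" e] u e unfolding t by simp
    have perp: "norm (u - (u \<bullet> e) *\<^sub>R e) < \<rho>"
    proof -
      have "u - a *\<^sub>R e = (u - (u \<bullet> e) *\<^sub>R e) + t *\<^sub>R e"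
        by (simp add: t_def algebra_simps)
      moreover have "orthogonal (u - (u \<bullet> e) *\<^sub>R e) (t *\<^sub>R e)"
        by (simp add: orthogonal_def inner_diff_left ee)
      ultimately have "(norm (u - a *\<^sub>R e))\<^sup>2 = (norm (u - (u \<bullet> e) *\<^sub>R e))\<^sup>2 + (norm (t *\<^sub>R e))\<^sup>2"
        by (metis norm_add_Pythagorean)
      then have "(norm (u - (u \<bullet> e) *\<^sub>R e))\<^sup>2 \<le> (norm (u - a *\<^sub>R e))\<^sup>2"
        by simp
      then show ?thesis using u by (meson norm_ge_zero order_le_less_trans power2_le_imp_le)
    qed
    define k where "k = \<lfloor>t / h\<rfloor>"
    have k1: "of_int k * h \<le> t" "t < of_int k * h + h"
      using h floor_correct[of "t / h"] unfolding k_def[symmetric] by (auto simp: field_simps)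
    have "- (\<rho> / h) < t / h" "t / h < \<rho> / h"
      using t_less h by (auto simp: field_simps abs_less_iff)
    moreover have "\<rho> / h \<le> of_int N" by (simp add: N_def)
    ultimately have "of_int (- N) \<le> t / h" "t / h < of_int N" by simp_all
    then have "k \<in> I" unfolding I_def k_def by (simp add: le_floor_iff floor_less_iff del: of_int_minus)
    moreover have "u - (of_int k * h) *\<^sub>R e \<in> S"
    proof -
      have *: "(u - (of_int k * h) *\<^sub>R e) \<bullet> e = a + (t - of_int k * h)"
        by (simp add: t_def inner_diff_left ee)
      have "u - (of_int k * h) *\<^sub>R e - ((u - (of_int k * h) *\<^sub>R e) \<bullet> e) *\<^sub>R e
          = u - (u \<bullet> e) *\<^sub>R e"
        unfolding * by (simp add: t_def algebra_simps)
      then show ?thesis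
        using perp k1 * by (simp only: S_def mem_Collect_eq) simp
    qed
    then have "u \<in> T k"
      unfolding T_def by (rule rev_image_eqI) simp
    ultimately show "u \<in> (\<Union>k\<in>I. T k)" by blast
  qed
  have "measure lebesgue (ball (a *\<^sub>R e) \<rho>) \<le> measure lebesgue (\<Union>k\<in>I. T k)"
    by (rule measure_mono_fmeasurable[OF cover]) (auto simp: I_def intro!: fmeasurable.finite_UN T_lm)
  also have "\<dots> \<le> (\<Sum>k\<in>I. measure lebesgue (T k))"
    by (rule measure_UNION_le) (use T_lm in \<open>auto simp: I_def\<close>)
  also have "\<dots> = 2 * of_int N * measure lebesgue S"
  proof -
    have "0 \<le> \<rho> / h" using h by simp
    then have "0 \<le> N" unfolding N_def by linarith
    then show ?thesis by (simp add: T_meas I_def)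
  qed
  also have "\<dots> \<le> 2 * (2 * \<rho> / h) * measure lebesgue S"
  proof -
    have "of_int N \<le> \<rho> / h + 1" unfolding N_def by linarith
    also have "\<dots> \<le> 2 * \<rho> / h" using h by (simp add: field_simps)
    finally show ?thesis by (intro mult_right_mono mult_left_mono) auto
  qed
  finally have "unit_ball_vol (real DIM('a)) * \<rho> ^ DIM('a) \<le> 4 * \<rho> / h * measure lborel S"
    using h S_borel by (simp add: content_ball measure_completion)
  moreover have "\<rho> ^ DIM('a) = \<rho> * \<rho> ^ (DIM('a) - 1)"
    using DIM_positive[where 'a='a] by (metis power_eq_if not_gr_zero)
  ultimately show "unit_ball_vol (real DIM('a)) * \<rho> ^ (DIM('a) - 1) * h / 4 \<le> measure lborel S"
    using h by (simp add: field_simps)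
qed

section \<open>Polynomials near a maximum on the boundary of a ball\<close>

lemma cos_le_quadratic:
  fixes t :: real
  assumes "0 \<le> t" "t \<le> 1"
  shows "cos t \<le> 1 - t\<^sup>2 / 4"
proof -
  define u where "u = t / 2"
  have u: "0 \<le> u" "u \<le> 1 / 2" using assms by (auto simp: u_def)
  have "\<bar>sin u - (\<Sum>m<3. sin_coeff m * u ^ m)\<bar> \<le> inverse (fact 3) * \<bar>u\<bar> ^ 3"
    by (rule Maclaurin_sin_bound)
  then have "\<bar>sin u - u\<bar> \<le> u ^ 3 / 6"
    using u by (simp add: sin_coeff_def eval_nat_numeral)
  moreover have "u ^ 3 \<le> u"
    using u power_decreasing[of 1 3 u] by simp
  ultimately have "5 / 6 * u \<le> sin u" by linarith
  then have "(5 / 6 * u)\<^sup>2 \<le> (sin u)\<^sup>2"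
    using u by (intro power_mono) auto
  then have "u\<^sup>2 / 2 \<le> (sin u)\<^sup>2"
    by (simp add: power_mult_distrib power_divide) (smt (verit) zero_le_power2)
  moreover have "cos t = 1 - 2 * (sin u)\<^sup>2"
    using cos_double_sin[of u] by (simp add: u_def)
  ultimately show ?thesis by (simp add: u_def power_divide)
qed

text \<open>
  Every point \<open>y\<close> of the cap lies on an ellipse through the pole \<open>c + r e\<close> that is centred at \<open>c\<close>, stays
  inside the closed ball, and reaches \<open>y\<close> after a parameter time of at most \<open>\<delta>\<close>: one semi-axis is \<open>r e\<close>,
  the other one, \<open>b\<close>, is orthogonal to it and not longer. Since the polynomial is bounded by \<open>M\<close> on the
  whole ellipse, it changes by at most \<open>M / 4\<close> between the pole and \<open>y\<close>.
\<close>

lemma polynomial_large_on_cap: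
  fixes p :: "real ^ 'd \<Rightarrow> real"
  assumes p: "p \<in> polys_upto l"
    and bound: "\<And>y. y \<in> cball c r \<Longrightarrow> \<bar>p y\<bar> \<le> M"
    and e: "norm e = 1" and large: "3 / 4 * M \<le> \<bar>p (c + r *\<^sub>R e)\<bar>"
    and \<delta>: "0 \<le> \<delta>" "\<delta> \<le> pi" "exp 1 * (real l + 1) * \<delta> \<le> 1 / 4"
    and y: "y \<in> ball c r" "r * cos \<delta> \<le> (y - c) \<bullet> e"
  shows "M / 2 \<le> \<bar>p y\<bar>"
proof -
  have r: "0 < r" using y(1) by (smt (verit) mem_ball zero_le_dist)
  have M: "0 \<le> M" using bound[of c] r by fastforce
  have ee: "e \<bullet> e = 1" using e by (simp add: norm_eq_1)
  have y_norm: "norm (y - c) < r" using y(1) by (simp add: dist_norm norm_minus_commute)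
  define t where "t = (y - c) \<bullet> e / r"
  define w where "w = y - c - (r * t) *\<^sub>R e"
  have rt: "r * t = (y - c) \<bullet> e" using r by (simp add: t_def)
  have "\<bar>r * t\<bar> < r"
    using Cauchy_Schwarz_ineq2[of "y - c" e] e y_norm unfolding rt by simp
  then have t_abs: "\<bar>t\<bar> \<le> 1" using r by (simp add: abs_mult)
  have t_cos: "cos \<delta> \<le> t" using y(2) r by (simp add: t_def field_simps)
  have ortho: "e \<bullet> w = 0"
    unfolding w_def rt by (simp add: inner_diff_right ee inner_commute)
  define \<theta> where "\<theta> = arccos t"
  have \<theta>: "0 \<le> \<theta>" "\<theta> \<le> pi" "cos \<theta> = t"
    using t_abs arccos_lbound arccos_ubound cos_arccos_abs unfolding \<theta>_def by auto
  have \<theta>_le: "\<theta> \<le> \<delta>"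
    using \<theta> \<delta> t_cos by (metis cos_mono_le_eq)
  have "(norm (y - c))\<^sup>2 = (norm ((r * t) *\<^sub>R e))\<^sup>2 + (norm w)\<^sup>2"
  proof -
    have "y - c = (r * t) *\<^sub>R e + w" by (simp add: w_def)
    then show ?thesis
      using norm_add_Pythagorean[of "(r * t) *\<^sub>R e" w] ortho by (simp add: orthogonal_def)
  qed
  then have "(r * t)\<^sup>2 + (norm w)\<^sup>2 = (norm (y - c))\<^sup>2" using e by (simp add: power_mult_distrib)
  also have "\<dots> < r\<^sup>2" using y_norm by (simp add: power_strict_mono)
  finally have w_less: "(norm w)\<^sup>2 < (r * sin \<theta>)\<^sup>2"
    using \<theta>(3) by (simp add: power_mult_distrib sin_squared_eq algebra_simps)
  then have sin_pos: "0 < sin \<theta>"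
    using \<theta> sin_ge_zero[of \<theta>] by (cases "sin \<theta> = 0") auto
  have "norm w \<le> r * sin \<theta>"
    using w_less r sin_pos by (meson less_imp_le mult_pos_pos power2_le_imp_le)
  define b where "b = w /\<^sub>R sin \<theta>"
  have b: "norm b \<le> r" "e \<bullet> b = 0"
    using \<open>norm w \<le> r * sin \<theta>\<close> sin_pos ortho by (auto simp: b_def field_simps)
  have y_eq: "y = c + cos \<theta> *\<^sub>R (r *\<^sub>R e) + sin \<theta> *\<^sub>R b"
    using sin_pos by (simp add: b_def w_def \<theta>(3) mult.commute)
  have ellipse: "c + cos s *\<^sub>R (r *\<^sub>R e) + sin s *\<^sub>R b \<in> cball c r" for s
  proof -
    have "(norm (cos s *\<^sub>R (r *\<^sub>R e) + sin s *\<^sub>R b))\<^sup>2 = (r * cos s)\<^sup>2 + (sin s * norm b)\<^sup>2"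
      using b(2) e norm_add_Pythagorean[of "cos s *\<^sub>R (r *\<^sub>R e)" "sin s *\<^sub>R b"]
      by (simp add: orthogonal_def power_mult_distrib mult.commute)
    also have "\<dots> \<le> (r * cos s)\<^sup>2 + (sin s * r)\<^sup>2"
      using b(1) r by (simp add: power_mult_distrib mult_left_mono power_mono)
    also have "\<dots> = r\<^sup>2 * ((sin s)\<^sup>2 + (cos s)\<^sup>2)" by (simp only: power_mult_distrib distrib_left mult.commute add.commute)
    also have "\<dots> = r\<^sup>2" by simp
    finally have "norm (cos s *\<^sub>R (r *\<^sub>R e) + sin s *\<^sub>R b) \<le> r"
      by (rule power2_le_imp_le) (use r in simp)
    then show ?thesis
      by (simp only: mem_cball dist_norm norm_minus_commute[of c] add.assoc add_diff_cancel_left')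
  qed
  have "\<bar>p y - p (c + r *\<^sub>R e)\<bar> \<le> exp 1 * (real l + 1) * M * \<bar>\<theta>\<bar>"
    unfolding y_eq using polynomial_variation_along_ellipse[OF p bound[OF ellipse]] .
  also have "\<dots> = (exp 1 * (real l + 1) * \<theta>) * M" using \<theta> by simp
  also have "\<dots> \<le> (exp 1 * (real l + 1) * \<delta>) * M"
    using \<theta>_le M by (intro mult_right_mono mult_left_mono) auto
  also have "\<dots> \<le> 1 / 4 * M" by (rule mult_right_mono[OF \<delta>(3) M])
  finally show ?thesis using large by linarith
qed

text \<open>
  The cap of angle \<open>\<delta>\<close> has depth of order \<open>\<delta>\<^sup>2\<close> but width of order \<open>\<delta>\<close>, so that its volume is of order
  \<open>\<delta> ^ (d + 1)\<close> rather than \<open>\<delta> ^ (2 * d)\<close>. This is where the exponent \<open>d + 1\<close> comes from.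
\<close>

lemma polynomial_large_on_big_set:
  fixes p :: "real ^ 'd \<Rightarrow> real"
  assumes p: "p \<in> polys_upto l" and r: "0 < r"
    and bound: "\<And>y. y \<in> cball c r \<Longrightarrow> \<bar>p y\<bar> \<le> M"
    and e: "norm e = 1" and large: "3 / 4 * M \<le> \<bar>p (c + r *\<^sub>R e)\<bar>"
    and \<delta>: "0 < \<delta>" "\<delta> \<le> 1" "exp 1 * (real l + 1) * \<delta> \<le> 1 / 4"
  shows "\<exists>S \<in> sets borel. S \<subseteq> ball c r \<and> (\<forall>y\<in>S. M / 2 \<le> \<bar>p y\<bar>) \<and>
    unit_ball_vol CARD('d) / 8 * (r / 4) ^ CARD('d) * \<delta> ^ (CARD('d) + 1) \<le> measure lborel S"
proof -
  \<comment> \<open>A slab inside the cap, away from the pole: leaving out the depth up to \<open>r \<delta>\<^sup>2 / 8\<close> makes room for the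
    width \<open>r \<delta> / 4\<close> inside the ball, and the depth \<open>r \<delta>\<^sup>2 / 4\<close> is still within the angle \<open>\<delta>\<close>.\<close>
  define S0 where "S0 = {u. r * (1 - \<delta>\<^sup>2 / 4) \<le> u \<bullet> e \<and> u \<bullet> e < r * (1 - \<delta>\<^sup>2 / 4) + r * \<delta>\<^sup>2 / 8 \<and>
     norm (u - (u \<bullet> e) *\<^sub>R e) < r * \<delta> / 4}"
  have \<delta>2: "\<delta>\<^sup>2 \<le> \<delta>" "0 < \<delta>\<^sup>2" using \<delta> by (auto simp: power2_eq_square mult_left_le)
  have h: "0 < r * \<delta>\<^sup>2 / 8" "r * \<delta>\<^sup>2 / 8 \<le> r * \<delta> / 4"
    using \<delta>2 \<delta> r by (auto simp: mult_left_mono)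
  have S0: "S0 \<in> sets borel"
    and vol: "unit_ball_vol CARD('d) * (r * \<delta> / 4) ^ (CARD('d) - 1) * (r * \<delta>\<^sup>2 / 8) / 4 \<le> measure lborel S0"
    using disc_slab_volume[OF e h, of "r * (1 - \<delta>\<^sup>2 / 4)"] unfolding S0_def by auto
  define S where "S = (+) c ` S0"
  have "S = (\<lambda>y. y - c) -` S0 \<inter> space borel"
    unfolding S_def by (force simp: image_iff)
  then have S: "S \<in> sets borel"
    using S0 by (simp only:) (rule measurable_sets, auto)
  have meas: "measure lborel S = measure lborel S0"
    using measure_translation[of c S0] S S0 unfolding S_def by (simp add: measure_completion)
  have vol_eq: "unit_ball_vol CARD('d) / 8 * (r / 4) ^ CARD('d) * \<delta> ^ (CARD('d) + 1)
     = unit_ball_vol CARD('d) * (r * \<delta> / 4) ^ (CARD('d) - 1) * (r * \<delta>\<^sup>2 / 8) / 4"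
  proof -
    obtain m where m: "CARD('d) = Suc m" using zero_less_card_finite gr0_conv_Suc by metis
    show ?thesis unfolding m
      by (simp add: power_divide power_mult_distrib power2_eq_square field_simps)
  qed
  have "u + c \<in> ball c r \<and> r * cos \<delta> \<le> u \<bullet> e" if u: "u \<in> S0" for u
  proof 
    have ee: "e \<bullet> e = 1" using e by (simp add: norm_eq_1)
    have le: "\<delta>\<^sup>2 \<le> 1" using \<delta> \<delta>2 by linarith
    have "orthogonal (u - (u \<bullet> e) *\<^sub>R e) ((u \<bullet> e) *\<^sub>R e)"
      by (simp add: orthogonal_def inner_diff_left ee)
    from norm_add_Pythagorean[OF this]
    have "(norm u)\<^sup>2 = (norm (u - (u \<bullet> e) *\<^sub>R e))\<^sup>2 + (u \<bullet> e)\<^sup>2"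
      using e by simp
    also have "\<dots> < (r * \<delta> / 4)\<^sup>2 + (r * (1 - \<delta>\<^sup>2 / 8))\<^sup>2"
    proof (rule add_less_le_mono)
      show "(norm (u - (u \<bullet> e) *\<^sub>R e))\<^sup>2 < (r * \<delta> / 4)\<^sup>2"
        using u by (intro power_strict_mono) (auto simp: S0_def)
      show "(u \<bullet> e)\<^sup>2 \<le> (r * (1 - \<delta>\<^sup>2 / 8))\<^sup>2"
      proof (rule power_mono)
        have "0 \<le> r * (1 - \<delta>\<^sup>2 / 4)" using r le by simp
        then show "0 \<le> u \<bullet> e" using u by (simp add: S0_def)
        show "u \<bullet> e \<le> r * (1 - \<delta>\<^sup>2 / 8)" using u by (simp add: S0_def algebra_simps)
      qed
    qed
    also have "\<dots> = r\<^sup>2 * (1 - \<delta>\<^sup>2 * (3 / 16 - \<delta>\<^sup>2 / 64))"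
      by (simp add: power2_eq_square field_simps)
    also have "\<dots> \<le> r\<^sup>2 * 1"
      using le by (intro mult_left_mono) auto
    finally have "norm u < r"
      using r by (simp add: power2_less_imp_less)
    then show "u + c \<in> ball c r" by (simp add: dist_norm)
    have "r * cos \<delta> \<le> r * (1 - \<delta>\<^sup>2 / 4)"
      using cos_le_quadratic[of \<delta>] \<delta> r by (intro mult_left_mono) auto
    then show "r * cos \<delta> \<le> u \<bullet> e" using u by (simp add: S0_def)
  qed
  then have "y \<in> ball c r \<and> r * cos \<delta> \<le> (y - c) \<bullet> e" if "y \<in> S" for y
    using that unfolding S_def by (auto simp: add.commute)
  then have cap: "y \<in> ball c r" "r * cos \<delta> \<le> (y - c) \<bullet> e" if "y \<in> S" for y
    using that by blast+
  have \<delta>_pi: "0 \<le> \<delta>" "\<delta> \<le> pi" using \<delta>(1,2) pi_gt3 by linarith+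
  have "S \<subseteq> ball c r" using cap by blast
  moreover have "\<forall>y\<in>S. M / 2 \<le> \<bar>p y\<bar>"
    using polynomial_large_on_cap[OF p bound e large \<delta>_pi \<delta>(3)] cap by blast
  ultimately show ?thesis using S vol unfolding vol_eq meas[symmetric] by blast
qed

section \<open>The interior sphere condition\<close>

text \<open>
  The interior sphere condition at a point \<open>x\<close> of the domain itself, not only at boundary points: \<open>x\<close>
  lies on the boundary of a ball of radius \<open>r\<close> inside \<open>D\<close>, and \<open>e\<close> is the outer normal there.
\<close>

definition inner_ball :: "'a :: real_inner set \<Rightarrow> real \<Rightarrow> 'a \<Rightarrow> bool" where
  "inner_ball D r x \<longleftrightarrow> (\<exists>e. norm e = 1 \<and> ball (x - r *\<^sub>R e) r \<subseteq> D)"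

lemma inner_ball_mono:
  assumes "inner_ball D r x" "0 \<le> r'" "r' \<le> r"
  shows "inner_ball D r' x"
proof -
  obtain e where e: "norm e = 1" "ball (x - r *\<^sub>R e) r \<subseteq> D"
    using assms by (auto simp: inner_ball_def)
  have "dist (x - r *\<^sub>R e) (x - r' *\<^sub>R e) = r - r'"
    using e assms by (simp add: dist_norm flip: scaleR_left_diff_distrib)
  then have "ball (x - r' *\<^sub>R e) r' \<subseteq> ball (x - r *\<^sub>R e) r"
    by (auto simp: mem_ball) (smt (verit) dist_triangle)
  then show ?thesis
    using e by (auto simp: inner_ball_def)
qed

text \<open>
  By Taylor's formula, \<open>F (x + v) \<ge> F x + G x \<bullet> v - K * (norm v)\<^sup>2\<close>. For \<open>x + v\<close> in the ball of radius
  \<open>r\<close> that touches \<open>x\<close> and has its centre in the direction of the gradient, the linear term exceeds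
  \<open>(norm v)\<^sup>2 / (2 * r)\<close>, which dominates the quadratic term when \<open>2 * K * r \<le> 1\<close>.
\<close>

lemma inner_ball_superlevel_set:
  fixes F :: "'a :: euclidean_space \<Rightarrow> real"
  assumes F: "\<And>x. (F has_derivative (\<lambda>h. G x \<bullet> h)) (at x)"
    and lip: "\<And>x y. x \<in> ball p R \<Longrightarrow> y \<in> ball p R \<Longrightarrow> norm (G x - G y) \<le> K * norm (x - y)"
    and grad: "\<And>x. 1 \<le> norm (G x)"
    and D: "{x \<in> ball p R. F x > 0} \<subseteq> D"
    and r: "0 < r" "4 * r \<le> R" "2 * K * r \<le> 1"
    and x: "x \<in> ball p (R / 2)" "F x > 0"
  shows "inner_ball D r x"
proof -
  define \<nu> where "\<nu> = G x /\<^sub>R norm (G x)"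
  have G_pos: "0 < norm (G x)" using grad[of x] by linarith
  have \<nu>: "norm \<nu> = 1" using G_pos by (simp add: \<nu>_def)
  have R: "R / 2 \<le> R" using r by linarith
  have "ball (x - r *\<^sub>R (- \<nu>)) r \<subseteq> D"
  proof
    fix z assume "z \<in> ball (x - r *\<^sub>R (- \<nu>)) r"
    define v where "v = z - x"
    have "norm (v - r *\<^sub>R \<nu>) < r"
      using \<open>z \<in> _\<close> by (simp add: v_def dist_norm norm_minus_commute algebra_simps)
    then have "(norm (v - r *\<^sub>R \<nu>))\<^sup>2 < r\<^sup>2"
      by (simp add: power_strict_mono)
    moreover have "(norm (v - r *\<^sub>R \<nu>))\<^sup>2 = (norm v)\<^sup>2 - 2 * r * (\<nu> \<bullet> v) + r\<^sup>2"
      using \<nu> unfolding power2_norm_eq_inner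
      by (simp add: inner_diff_left inner_diff_right inner_commute norm_eq_1 power2_eq_square algebra_simps)
    ultimately have v_less: "(norm v)\<^sup>2 < 2 * r * (\<nu> \<bullet> v)" by simp
    have seg: "closed_segment x z \<subseteq> ball p R"
    proof -
      have "norm v \<le> norm (v - r *\<^sub>R \<nu>) + norm (r *\<^sub>R \<nu>)"
        by (metis diff_add_cancel norm_triangle_ineq)
      then have "norm v < R / 2"
        using \<open>norm (v - r *\<^sub>R \<nu>) < r\<close> \<nu> r by simp
      then have "z \<in> ball p R"
        using x(1) dist_triangle[of p z x] by (simp add: v_def dist_norm norm_minus_commute)
      moreover have "x \<in> ball p R" using x(1) R by simp
      ultimately show ?thesis
        by (simp add: closed_segment_subset)
    qed
    have "norm (F z - F x - G x \<bullet> (z - x)) \<le> norm (z - x) * (K * norm v)"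
    proof (rule differentiable_bound_linearization[where f = F and f' = "\<lambda>y h. G y \<bullet> h" and S = "closed_segment x z"])
      fix y assume y: "y \<in> closed_segment x z"
      show "(F has_derivative (\<lambda>h. G y \<bullet> h)) (at y within closed_segment x z)"
        by (rule has_derivative_at_withinI[OF F])
      have K: "norm (G y - G x) \<le> K * norm (y - x)"
        using lip y seg by (meson ends_in_segment(1) subsetD)
      have "0 \<le> K * norm v"
        using lip[of z x] seg norm_ge_zero unfolding v_def
        by (meson ends_in_segment order_trans subsetD)
      have "norm (y - x) \<le> norm v"
        using segment_bound1[OF y] by (simp add: v_def)
      then have "norm (G y - G x) \<le> K * norm v"
        using K \<open>0 \<le> K * norm v\<close> by (smt (verit, best) mult_left_mono mult_nonneg_nonpos2 norm_ge_zero mult_le_0_iff zero_le_mult_iff)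
      moreover have "norm (((\<lambda>h. G y \<bullet> h) - (\<lambda>h. G x \<bullet> h)) h) \<le> norm (G y - G x) * norm h" for h
        using Cauchy_Schwarz_ineq2[of "G y - G x" h] by (simp add: inner_diff_left)
      then have "onorm ((\<lambda>h. G y \<bullet> h) - (\<lambda>h. G x \<bullet> h)) \<le> norm (G y - G x)"
        by (rule onorm_le)
      ultimately show "onorm ((\<lambda>h. G y \<bullet> h) - (\<lambda>h. G x \<bullet> h)) \<le> K * norm v"
        by linarith
    qed (auto simp: in_segment algebra_simps)
    then have "F z \<ge> F x + G x \<bullet> v - K * (norm v)\<^sup>2"
      by (simp add: v_def power2_eq_square abs_le_iff algebra_simps)
    moreover have "K * (norm v)\<^sup>2 \<le> G x \<bullet> v"
    proof -
      have \<nu>v: "0 \<le> \<nu> \<bullet> v"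
        using v_less r by (smt (verit) mult_nonneg_nonpos zero_le_power2)
      have "K * (norm v)\<^sup>2 \<le> \<nu> \<bullet> v"
      proof (cases "0 \<le> K")
        case True
        then have "K * (norm v)\<^sup>2 \<le> K * (2 * r * (\<nu> \<bullet> v))"
          using v_less by (intro mult_left_mono) auto
        also have "\<dots> = (2 * K * r) * (\<nu> \<bullet> v)" by simp
        also have "\<dots> \<le> 1 * (\<nu> \<bullet> v)" by (rule mult_right_mono[OF r(3) \<nu>v])
        finally show ?thesis by simp
      next
        case False
        then show ?thesis using \<nu>v by (smt (verit) mult_nonpos_nonneg zero_le_power2)
      qed
      also have "\<dots> \<le> norm (G x) * (\<nu> \<bullet> v)"
        using mult_right_mono[OF grad[of x] \<nu>v] by simp
      also have "\<dots> = G x \<bullet> v" using G_pos by (simp add: \<nu>_def)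
      finally show ?thesis .
    qed
    ultimately have "F z > 0" using x by linarith
    moreover have "z \<in> ball p R" using seg by auto
    ultimately show "z \<in> D" using D by blast
  qed
  then show ?thesis
    unfolding inner_ball_def using \<nu> by (metis norm_minus_cancel)
qed

text \<open>
  Near a boundary point the domain is the set where \<open>F x = s * x $ i - \<gamma> x\<close> is positive. As \<open>\<gamma>\<close> does
  not depend on the \<open>i\<close>-th coordinate, the gradient of \<open>F\<close> has \<open>i\<close>-th component \<open>s = \<plusminus>1\<close>, hence norm at
  least one; it is Lipschitz near the point because the second derivatives are bounded there.
\<close>

lemma C2_boundary_local_inner_ball:
  fixes D :: "(real ^ 'd) set"
  assumes "C2_boundary D" "p \<in> frontier D"
  shows "\<exists>\<rho>>0. \<exists>r>0. \<forall>x \<in> D \<inter> ball p \<rho>. inner_ball D r x"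
proof -
  have "\<exists>r>0. \<exists>i. \<exists>s\<in>{1, -1}. \<exists>\<gamma>. C2_function \<gamma> \<and>
      (\<forall>x y. (\<forall>j. j \<noteq> i \<longrightarrow> x $ j = y $ j) \<longrightarrow> \<gamma> x = \<gamma> y) \<and>
      D \<inter> ball p r = {x \<in> ball p r. s * x $ i > \<gamma> x}"
    using assms unfolding C2_boundary_def by (rule bspec)
  then obtain R i s \<gamma> where R: "R > 0" and s: "s \<in> {1, -1}" and C2: "C2_function \<gamma>"
    and indep: "\<forall>x y. (\<forall>j. j \<noteq> i \<longrightarrow> x $ j = y $ j) \<longrightarrow> \<gamma> x = \<gamma> y"
    and D: "D \<inter> ball p R = {x \<in> ball p R. s * x $ i > \<gamma> x}"
    by (elim exE conjE bexE)
  obtain g H where g: "\<And>x. (\<gamma> has_derivative (\<lambda>h. g x \<bullet> h)) (at x)"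
    and H: "\<And>x. (g has_derivative (\<lambda>h. H x *v h)) (at x)" and cont: "continuous_on UNIV H"
    using C2 unfolding C2_function_def by blast
  define F where "F = (\<lambda>x. s * x $ i - \<gamma> x)"
  define G where "G = (\<lambda>x. s *\<^sub>R axis i 1 - g x)"
  have F: "(F has_derivative (\<lambda>h. G x \<bullet> h)) (at x)" for x
  proof -
    have "((\<lambda>x. x $ i) has_derivative (\<lambda>h. h $ i)) (at x)"
      by (rule bounded_linear_imp_has_derivative[OF bounded_linear_vec_nth])
    then have "(F has_derivative (\<lambda>h. s * h $ i - g x \<bullet> h)) (at x)"
      unfolding F_def by (intro has_derivative_diff has_derivative_mult_right g)
    moreover have "(\<lambda>h. s * h $ i - g x \<bullet> h) = (\<lambda>h. G x \<bullet> h)"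
      by (simp add: G_def inner_diff_left inner_axis')
    ultimately show ?thesis by simp
  qed
  have grad: "1 \<le> norm (G x)" for x
  proof -
    have line: "((\<lambda>t::real. x + t *\<^sub>R axis i 1) has_derivative (\<lambda>t. t *\<^sub>R axis i 1)) (at 0)"
      by (auto intro!: derivative_eq_intros)
    have const: "(\<lambda>t::real. \<gamma> (x + t *\<^sub>R axis i 1)) = (\<lambda>t. \<gamma> x)"
    proof
      fix t :: real
      show "\<gamma> (x + t *\<^sub>R axis i 1) = \<gamma> x"
        by (rule indep[rule_format]) (simp add: axis_def)
    qed
    have "((\<lambda>t::real. \<gamma> x) has_derivative (\<lambda>t. g x \<bullet> (t *\<^sub>R axis i 1))) (at 0)"
      using has_derivative_compose[OF line, of \<gamma> "\<lambda>h. g x \<bullet> h"] g[of x] unfolding const by simp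
    then have "(\<lambda>t::real. g x \<bullet> (t *\<^sub>R axis i 1)) = (\<lambda>t. 0)"
      by (rule has_derivative_unique) (rule has_derivative_const)
    from fun_cong[OF this, of 1] have "g x \<bullet> axis i 1 = 0"
      by simp
    then have "G x \<bullet> axis i 1 = s"
      by (simp add: G_def inner_diff_left inner_axis)
    then show ?thesis
      using Cauchy_Schwarz_ineq2[of "G x" "axis i 1"] s by auto
  qed
  have "continuous_on (cball p R) H"
    by (rule continuous_on_subset[OF cont]) simp
  then have "continuous_on (cball p R) (\<lambda>x. \<Sum>a\<in>UNIV. \<Sum>b\<in>UNIV. \<bar>H x $ a $ b\<bar>)"
    by (intro continuous_on_sum continuous_on_rabs continuous_on_component)
  then have "bounded ((\<lambda>x. \<Sum>a\<in>UNIV. \<Sum>b\<in>UNIV. \<bar>H x $ a $ b\<bar>) ` cball p R)"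
    by (intro compact_imp_bounded compact_continuous_image compact_cball)
  then obtain K where K: "K > 0" "\<forall>y\<in>(\<lambda>x. \<Sum>a\<in>UNIV. \<Sum>b\<in>UNIV. \<bar>H x $ a $ b\<bar>) ` cball p R. norm y \<le> K"
    unfolding bounded_pos by blast
  have lip: "norm (G x - G y) \<le> K * norm (x - y)" if "x \<in> ball p R" "y \<in> ball p R" for x y
  proof -
    have "norm (g y - g x) \<le> K * norm (y - x)"
    proof (rule differentiable_bound[where S = "ball p R"])
      fix z assume "z \<in> ball p R"
      then have "norm (\<Sum>a\<in>UNIV. \<Sum>b\<in>UNIV. \<bar>H z $ a $ b\<bar>) \<le> K"
        using K(2) ball_subset_cball by blast
      then show "onorm ((*v) (H z)) \<le> K"
        using onorm_le_matrix_component_sum[of "H z"] by simp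
      show "(g has_derivative (*v) (H z)) (at z within ball p R)"
        by (rule has_derivative_at_withinI[OF H])
    qed (use that in simp_all)
    then show ?thesis by (simp add: G_def norm_minus_commute)
  qed
  define r where "r = min (R / 4) (1 / (2 * K))"
  have r: "0 < r" "4 * r \<le> R" "2 * K * r \<le> 1"
  proof -
    have "r \<le> R / 4" "r \<le> 1 / (2 * K)" by (simp_all add: r_def)
    then show "4 * r \<le> R" "2 * K * r \<le> 1" using K(1) by (simp_all add: field_simps)
    show "0 < r" using R K(1) by (simp add: r_def)
  qed
  have sub: "{x \<in> ball p R. 0 < F x} \<subseteq> D"
    using D unfolding F_def by auto
  have "inner_ball D r x" if x: "x \<in> D \<inter> ball p (R / 2)" for x
  proof (rule inner_ball_superlevel_set[OF F lip grad sub r])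
    show "x \<in> ball p (R / 2)" using x by simp
    have "ball p (R / 2) \<subseteq> ball p R" using R by (intro subset_ball) simp
    then have "x \<in> D \<inter> ball p R" using x by blast
    then show "0 < F x" unfolding D F_def by simp
  qed
  moreover have "R / 2 > 0" using R by simp
  ultimately show ?thesis using r(1) by blast
qed

lemma open_local_inner_ball:
  fixes D :: "'a :: euclidean_space set"
  assumes "open D" "p \<in> D"
  shows "\<exists>\<rho>>0. \<exists>r>0. \<forall>x \<in> D \<inter> ball p \<rho>. inner_ball D r x"
proof -
  obtain R where R: "R > 0" "ball p R \<subseteq> D"
    using assms by (meson open_contains_ball)
  obtain e :: 'a where e: "norm e = 1"
    using norm_Basis[OF SOME_Basis] by blast
  have "inner_ball D (R / 4) x" if "x \<in> ball p (R / 2)" for x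
  proof -
    have "ball (x - (R / 4) *\<^sub>R e) (R / 4) \<subseteq> ball p R"
    proof
      fix y assume y: "y \<in> ball (x - (R / 4) *\<^sub>R e) (R / 4)"
      have "dist p y \<le> dist p x + dist x (x - (R / 4) *\<^sub>R e) + dist (x - (R / 4) *\<^sub>R e) y"
        using dist_triangle[of p y x] dist_triangle[of x y "x - (R / 4) *\<^sub>R e"] by linarith
      moreover have "dist x (x - (R / 4) *\<^sub>R e) = R / 4"
        using e R by (simp add: dist_norm)
      ultimately show "y \<in> ball p R" using y that by auto
    qed
    then show ?thesis using R e by (auto simp: inner_ball_def)
  qed
  then show ?thesis using R by (intro exI[of _ "R / 2"] conjI exI[of _ "R / 4"]) auto
qed

text \<open>
  Balls may be shrunk, so a common radius exists by compactness of the closure of \<open>D\<close>.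
\<close>

lemma C2_boundary_inner_ball:
  fixes D :: "(real ^ 'd) set"
  assumes "open D" "bounded D" "C2_boundary D"
  shows "\<exists>r>0. \<forall>x\<in>D. inner_ball D r x"
proof -
  have "\<exists>\<rho>>0. \<exists>r>0. \<forall>x \<in> D \<inter> ball p \<rho>. inner_ball D r x" if "p \<in> closure D" for p
  proof (cases "p \<in> D")
    case False
    then have "p \<in> frontier D"
      using that assms by (simp add: frontier_def interior_open)
    then show ?thesis
      using assms C2_boundary_local_inner_ball by blast
  qed (use assms open_local_inner_ball in blast)
  then obtain \<rho> r where loc: "\<And>p. p \<in> closure D \<Longrightarrow> \<rho> p > 0 \<and> r p > 0 \<and> (\<forall>x \<in> D \<inter> ball p (\<rho> p). inner_ball D (r p) x)"
    by metis
  have "compact (closure D)" using assms by (simp add: compact_closure)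
  moreover have "closure D \<subseteq> (\<Union>p\<in>closure D. ball p (\<rho> p))"
    using loc by (auto intro!: bexI)
  ultimately obtain P where P: "P \<subseteq> closure D" "finite P" "closure D \<subseteq> (\<Union>p\<in>P. ball p (\<rho> p))"
    using compactE_image[of "closure D" "closure D" "\<lambda>p. ball p (\<rho> p)"] by auto
  define r0 where "r0 = Min (insert 1 (r ` P))"
  have r0: "r0 > 0" using P loc by (auto simp: r0_def Min_gr_iff)
  have "inner_ball D r0 x" if x: "x \<in> D" for x
  proof -
    obtain p where p: "p \<in> P" "x \<in> ball p (\<rho> p)"
      using P closure_subset x by blast
    then have "inner_ball D (r p) x" using loc P x by blast
    moreover have "r0 \<le> r p" using P p by (auto simp: r0_def)
    ultimately show ?thesis using r0 by (auto intro: inner_ball_mono)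
  qed
  then show ?thesis using r0 by blast
qed

section \<open>The supremum of a polynomial and its mean square\<close>

lemma polys_upto_continuous: "p \<in> polys_upto l \<Longrightarrow> continuous_on S p"
  by (auto simp: polys_upto_def intro!: continuous_intros)

text \<open>
  A point \<open>x0\<close> where the polynomial nearly attains its supremum \<open>M\<close> lies on the boundary of a ball inside
  \<open>D\<close>. On the cap of that ball at \<open>x0\<close> the polynomial is at least \<open>M / 2\<close>, so that the volume of the cap
  bounds the \<open>L\<^sup>2\<close> norm from below. It is essential that \<open>M\<close> is the supremum over all of \<open>D\<close>: it then
  bounds the polynomial on the ball, wherever the ball lies.
\<close>

lemma sup_bound_by_L2_norm:
  fixes D :: "(real ^ 'd) set"
  assumes D: "open D" "bounded D" and r: "0 < r" and ball: "\<And>x. x \<in> D \<Longrightarrow> inner_ball D r x"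
    and p: "p \<in> polys_upto l" and x: "x \<in> D"
    and \<delta>: "0 < \<delta>" "\<delta> \<le> 1" "exp 1 * (real l + 1) * \<delta> \<le> 1 / 4"
  shows "unit_ball_vol CARD('d) / 8 * (r / 4) ^ CARD('d) * \<delta> ^ (CARD('d) + 1) * \<bar>p x\<bar>\<^sup>2
    \<le> 4 * measure lborel D * (norm_L2 D p)\<^sup>2"
proof -
  let ?\<mu> = "uniform_measure lborel D"
  define \<kappa> where "\<kappa> = unit_ball_vol CARD('d) / 8 * (r / 4) ^ CARD('d) * \<delta> ^ (CARD('d) + 1)"
  have \<kappa>: "0 \<le> \<kappa>" using r \<delta> by (simp add: \<kappa>_def)
  have D_sets: "D \<in> sets lborel" using D by simp
  have fin: "emeasure lborel D \<noteq> \<infinity>"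
    using emeasure_bounded_finite[OF D(2)] by simp
  have nonnull: "emeasure lborel D \<noteq> 0"
    using D x open_not_negligible[of D] by (auto simp: negligible_iff_null_sets null_sets_def emeasure_lborel_countable)
  have vol_D: "0 < measure lborel D"
    using fin nonnull by (simp add: measure_def enn2real_positive_iff less_top zero_less_iff_neq_zero)
  have pcont: "continuous_on S p" for S by (rule polys_upto_continuous[OF p])
  define M where "M = (SUP y\<in>D. \<bar>p y\<bar>)"
  have "bounded (p ` closure D)"
    using D(2) by (intro compact_imp_bounded compact_continuous_image pcont) (simp add: compact_closure)
  then have "bounded (p ` D)"
    using bounded_subset closure_subset image_mono by metis
  then have bdd: "bdd_above ((\<lambda>y. \<bar>p y\<bar>) ` D)"
    by (auto simp: bounded_iff bdd_above_def)
  have M_D: "\<bar>p y\<bar> \<le> M" if "y \<in> D" for y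
    unfolding M_def using that by (rule cSUP_upper[OF _ bdd])
  have M_closure: "\<bar>p y\<bar> \<le> M" if "y \<in> closure D" for y
    using continuous_le_on_closure[of D "\<lambda>y. \<bar>p y\<bar>" y M] that M_D pcont by (simp add: continuous_on_rabs)
  have norm_sq: "(norm_L2 D p)\<^sup>2 = (\<integral>y. \<bar>p y\<bar>\<^sup>2 \<partial>?\<mu>)"
    unfolding norm_L2_def by (intro real_sqrt_pow2 integral_nonneg) simp
  have "\<kappa> * M\<^sup>2 \<le> 4 * measure lborel D * (norm_L2 D p)\<^sup>2"
  proof (cases "0 < M")
    case False
    then have "M = 0" using M_D[OF x] by linarith
    then show ?thesis using vol_D by simp
  next
    case True
    then have "3 / 4 * M < M" by simp
    then obtain x0 where x0: "x0 \<in> D" "3 / 4 * M < \<bar>p x0\<bar>"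
      unfolding M_def using less_cSUP_iff[OF _ bdd] x by blast
    obtain e where e: "norm e = 1" "ball (x0 - r *\<^sub>R e) r \<subseteq> D"
      using ball[OF x0(1)] by (auto simp: inner_ball_def)
    define c where "c = x0 - r *\<^sub>R e"
    have "cball c r \<subseteq> closure D"
      using closure_mono[OF e(2)] r unfolding c_def by simp
    then have M_ball: "\<And>y. y \<in> cball c r \<Longrightarrow> \<bar>p y\<bar> \<le> M"
      using M_closure by blast
    have large: "3 / 4 * M \<le> \<bar>p (c + r *\<^sub>R e)\<bar>" using x0(2) by (simp add: c_def)
    have "\<exists>S\<in>sets borel. S \<subseteq> ball c r \<and> (\<forall>y\<in>S. M / 2 \<le> \<bar>p y\<bar>) \<and> \<kappa> \<le> measure lborel S"
      unfolding \<kappa>_def by (rule polynomial_large_on_big_set[OF p r M_ball e(1) large \<delta>])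
    then obtain S where S: "S \<in> sets borel" "S \<subseteq> ball c r" "\<forall>y\<in>S. M / 2 \<le> \<bar>p y\<bar>"
        "\<kappa> \<le> measure lborel S"
      by blast
    have "D \<inter> S = S" using S(2) e(2) by (auto simp: c_def)
    interpret finite_measure ?\<mu>
    proof (rule finite_measureI)
      have "emeasure ?\<mu> UNIV = emeasure lborel D / emeasure lborel D"
        using emeasure_uniform_measure[OF D_sets, of UNIV] by simp
      also have "\<dots> = 1"
        using fin nonnull by (intro ennreal_divide_self) (auto simp: less_top)
      finally show "emeasure ?\<mu> (space ?\<mu>) \<noteq> \<infinity>" by simp
    qed
    have pM: "p \<in> borel_measurable borel"
      by (rule borel_measurable_continuous_onI[OF pcont])
    have "(M / 2)\<^sup>2 * measure ?\<mu> S = (\<integral>y. (M / 2)\<^sup>2 * indicator S y \<partial>?\<mu>)"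
      using S(1) by simp
    also have "\<dots> \<le> (\<integral>y. \<bar>p y\<bar>\<^sup>2 \<partial>?\<mu>)"
    proof (rule integral_mono)
      show "integrable ?\<mu> (\<lambda>y. (M / 2)\<^sup>2 * indicator S y)"
        using S(1) by (intro integrable_mult_right) (simp add: emeasure_finite less_top[symmetric])
      show "integrable ?\<mu> (\<lambda>y. \<bar>p y\<bar>\<^sup>2)"
      proof (rule integrable_const_bound[where B = "M\<^sup>2"])
        show "AE y in ?\<mu>. norm (\<bar>p y\<bar>\<^sup>2) \<le> M\<^sup>2"
        proof (intro AE_uniform_measureI D_sets AE_I2 impI)
          fix y assume "y \<in> D"
          then have "\<bar>p y\<bar>\<^sup>2 \<le> M\<^sup>2" by (intro power_mono M_D) auto
          then show "norm (\<bar>p y\<bar>\<^sup>2) \<le> M\<^sup>2" by simp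
        qed
        show "(\<lambda>y. \<bar>p y\<bar>\<^sup>2) \<in> borel_measurable ?\<mu>"
          using pM by simp
      qed
      show "(M / 2)\<^sup>2 * indicator S y \<le> \<bar>p y\<bar>\<^sup>2" for y
        using S(3) True power_mono[of "M / 2" "\<bar>p y\<bar>" 2] by (cases "y \<in> S") auto
    qed
    finally have "(M / 2)\<^sup>2 * (measure lborel S / measure lborel D) \<le> (norm_L2 D p)\<^sup>2"
      using fin nonnull S(1) \<open>D \<inter> S = S\<close> by (simp add: norm_sq)
    then have "measure lborel S * M\<^sup>2 \<le> 4 * measure lborel D * (norm_L2 D p)\<^sup>2"
      using vol_D by (simp add: power_divide field_simps)
    moreover have "\<kappa> * M\<^sup>2 \<le> measure lborel S * M\<^sup>2"
      by (rule mult_right_mono[OF S(4)]) simp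
    ultimately show ?thesis by linarith
  qed
  moreover have "\<kappa> * \<bar>p x\<bar>\<^sup>2 \<le> \<kappa> * M\<^sup>2"
    using M_D[OF x] \<kappa> by (intro mult_left_mono power_mono) auto
  ultimately show ?thesis unfolding \<kappa>_def by linarith
qed

text \<open>
  From \<open>(d + l) choose l \<ge> ((d + l) / d) ^ d\<close>: the dimension grows like \<open>l ^ d\<close>.
\<close>

lemma degree_power_le_dimension_power:
  assumes d: "0 < d"
  shows "(real l + 1) ^ (d + 1) \<le> real d ^ (d + 1) * real ((d + l) choose l) powr ((real d + 1) / real d)"
proof -
  define n where "n = (d + l) choose l"
  define q where "q = real (d + l) / real d"
  have q: "0 < q" using d by (simp add: q_def)
  have "n = (d + l) choose d"
    unfolding n_def by (subst binomial_symmetric) auto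
  then have "q ^ d \<le> real n"
    using binomial_ge_n_over_k_pow_k[of d "d + l", where 'a = real] by (simp add: q_def)
  then have "(q ^ d) powr ((real d + 1) / real d) \<le> real n powr ((real d + 1) / real d)"
    using q by (intro powr_mono2) auto
  moreover have "(q ^ d) powr ((real d + 1) / real d) = q ^ (d + 1)"
    using q d by (simp add: powr_powr powr_add add.commute flip: powr_realpow)
  ultimately have "real d ^ (d + 1) * q ^ (d + 1) \<le> real d ^ (d + 1) * real n powr ((real d + 1) / real d)"
    by (simp add: mult_left_mono)
  moreover have "(real l + 1) ^ (d + 1) \<le> (real d * q) ^ (d + 1)"
    using d by (intro power_mono) (auto simp: q_def)
  ultimately show ?thesis unfolding n_def power_mult_distrib by linarith
qed

theorem theorem5p5:
  fixes D :: "(real ^ 'd) set"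
  assumes "open D" and "bounded D" and "C2_boundary D"
  shows "\<exists>C :: real. \<forall>(l :: nat) (n :: nat). n = (CARD('d) + l) choose l \<longrightarrow>
           K_const D (polys_upto l) \<le> ereal (C * real n powr ((real CARD('d) + 1) / real CARD('d)))"
proof -
  let ?d = "CARD('d)"
  obtain r where r: "r > 0" "\<And>x. x \<in> D \<Longrightarrow> inner_ball D r x"
    using C2_boundary_inner_ball[OF assms] by blast
  define \<kappa> where "\<kappa> = unit_ball_vol ?d / 8 * (r / 4) ^ ?d"
  define A where "A = 4 * measure lborel D / \<kappa> * (4 * exp 1) ^ (?d + 1)"
  have \<kappa>: "0 < \<kappa>" using r by (simp add: \<kappa>_def)
  have A: "0 \<le> A" using \<kappa> by (simp add: A_def)
  have pointwise: "\<bar>v x\<bar>\<^sup>2 / (norm_L2 D v)\<^sup>2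
      \<le> A * real ?d ^ (?d + 1) * real ((?d + l) choose l) powr ((real ?d + 1) / real ?d)"
    if x: "x \<in> D" and v: "v \<in> polys_upto l" for x v l
  proof -
    \<comment> \<open>The angle within which a polynomial of degree \<open>l\<close> varies by at most a quarter of its maximum.\<close>
    define \<delta> where "\<delta> = 1 / (4 * exp 1 * (real l + 1))"
    have "1 \<le> 4 * exp 1 * (real l + 1)"
    proof -
      have "1 * 1 \<le> exp 1 * (real l + 1)" by (intro mult_mono) auto
      then show ?thesis by linarith
    qed
    then have \<delta>: "0 < \<delta>" "\<delta> \<le> 1" "exp 1 * (real l + 1) * \<delta> \<le> 1 / 4"
      by (auto simp: \<delta>_def divide_simps)
    have "\<kappa> * \<delta> ^ (?d + 1) * \<bar>v x\<bar>\<^sup>2 \<le> 4 * measure lborel D * (norm_L2 D v)\<^sup>2"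
      unfolding \<kappa>_def by (rule sup_bound_by_L2_norm[OF assms(1,2) r v x \<delta>])
    then have "\<bar>v x\<bar>\<^sup>2 \<le> 4 * measure lborel D * (norm_L2 D v)\<^sup>2 / (\<kappa> * \<delta> ^ (?d + 1))"
      using \<kappa> \<delta>(1) by (subst pos_le_divide_eq) (auto simp: mult.commute)
    also have "\<dots> = A * (real l + 1) ^ (?d + 1) * (norm_L2 D v)\<^sup>2"
      by (simp only: A_def \<delta>_def power_divide power_mult_distrib) (simp add: field_simps)
    finally have "\<bar>v x\<bar>\<^sup>2 / (norm_L2 D v)\<^sup>2 \<le> A * (real l + 1) ^ (?d + 1)"
      using A by (cases "norm_L2 D v = 0") (auto simp: divide_le_eq)
    also have "\<dots> \<le> A * (real ?d ^ (?d + 1) * real ((?d + l) choose l) powr ((real ?d + 1) / real ?d))"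
      by (intro mult_left_mono[OF _ A] degree_power_le_dimension_power) simp
    finally show ?thesis by (simp add: mult.assoc)
  qed
  show ?thesis
  proof (intro exI[of _ "A * real ?d ^ (?d + 1)"] allI impI)
    fix l n :: nat
    assume n: "n = (?d + l) choose l"
    show "K_const D (polys_upto l)
        \<le> ereal (A * real ?d ^ (?d + 1) * real n powr ((real ?d + 1) / real ?d))"
      unfolding K_const_def k_fun_def n
      by (intro SUP_least) (simp only: ereal_less_eq, rule pointwise, auto)
  qed
qed

end
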